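(* Let $A\in\mathbb{R}^{n_x\times n_x}$, $B\in\mathbb{R}^{n_x\times n_u}$, and let $Q\in\mathbb{R}^{n_x\times n_x}$, $R\in\mathbb{R}^{n_u\times n_u}$ be symmetric positive definite, with $(A,B)$ stabilizable. Let $\mathcal{K}=\{K\in\mathbb{R}^{n_u\times n_x}:\rho(A-BK)<1\}$, for $K\in\mathcal{K}$ let $$J(K)=\sup_{\omega\in[0,2\pi]}\lambda_{\max}^{1/2}\Big((e^{-j\omega}I-A+BK)^{-\mathsf{T}}(Q+K^{\mathsf{T}}RK)(e^{j\omega}I-A+BK)^{-1}\Big),$$ and $J^*=\min_{K\in\mathcal{K}}J(K)$. Let $K^0\in\mathcal{K}$ and $\Delta_0:=\mathrm{dist}(\mathcal{K}_{J(K^0)},\mathcal{K}^c)>0$. Fix any $\delta<\Delta_0$ and run Goldstein's subgradient method $K^{n+1}=K^n-\delta F^n/\|F^n\|_F$, where $F^n$ is the minimum-norm element of $\partial_\delta J(K^n)$. Then $K^n\in\mathcal{K}$ for all $n$, and for every $N$, $$\min_{0\le n\le N}\|F^n\|_F\le\frac{J(K^0)-J^*}{(N+1)\delta}.$$ In particular, with $\Delta:=J(K^0)-J^*$, for any $\delta<\Delta_0$ and $\epsilon>0$ one has $\min_{0\le n\le N}\|F^n\|_F\le\epsilon$ after $N=\mathcal{O}\big(\frac{\Delta}{\delta\epsilon}\big)$ iterations, i.e. a $(\delta,\epsilon)$-stationary point is found within $\mathcal{O}\big(\frac{\Delta}{\delta\epsilon}\big)$ iterations.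
   Context: $\rho(\cdot)$ denotes spectral radius, $j=\sqrt{-1}$, $\lambda_{\max}$ the largest eigenvalue of a Hermitian matrix, $\|\cdot\|_F$ the Frobenius norm, $\mathcal{K}^c$ the complement of $\mathcal{K}$, $\mathcal{K}_\gamma=\{K\in\mathcal{K}:J(K)\le\gamma\}$, $\mathrm{dist}$ the Frobenius-norm distance between sets. $J$ is locally Lipschitz on $\mathcal{K}$. The Clarke subdifferential is $\partial_CJ(K)=\mathrm{conv}\{\lim_i\nabla J(K_i):K_i\to K,\ K_i\text{ differentiability points of }J\}$; for $\mathbb{B}_\delta(K)\subset\mathcal{K}$ the Goldstein subdifferential is $\partial_\delta J(K)=\mathrm{conv}\big(\bigcup_{K'\in\mathbb{B}_\delta(K)}\partial_CJ(K')\big)$. A point $K$ is $(\delta,\epsilon)$-stationary if $\mathrm{dist}(0,\partial_\delta J(K))\le\epsilon$. *)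

theory Defs
  imports "HOL-Analysis.Analysis"
begin

text \<open>Matrices are rendered with finite index types: real ^ 'n ^ 'm is an m x n matrix.
  The norm on real ^ 'n ^ 'm is the Frobenius norm and the inner product is the
  Frobenius (trace) inner product.\<close>

definition cmat :: "real ^ 'n ^ 'm \<Rightarrow> complex ^ 'n ^ 'm" where
  "cmat M = (\<chi> i j. complex_of_real (M $ i $ j))"

definition is_eigenvalue :: "complex ^ 'n ^ 'n \<Rightarrow> complex \<Rightarrow> bool" where
  "is_eigenvalue M l \<longleftrightarrow> (\<exists>v. v \<noteq> 0 \<and> M *v v = l *s v)"

definition spec_rad :: "real ^ 'n ^ 'n \<Rightarrow> real" where
  "spec_rad M = Sup {cmod l | l. is_eigenvalue (cmat M) l}"

text \<open>Largest eigenvalue of a Hermitian matrix (its eigenvalues are real).\<close>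
definition lambda_max :: "complex ^ 'n ^ 'n \<Rightarrow> real" where
  "lambda_max H = Sup {Re l | l. is_eigenvalue H l}"

definition sym_pos_def :: "real ^ 'n ^ 'n \<Rightarrow> bool" where
  "sym_pos_def M \<longleftrightarrow> transpose M = M \<and> (\<forall>x. x \<noteq> 0 \<longrightarrow> x \<bullet> (M *v x) > 0)"

definition stabilizable :: "real ^ 'n ^ 'n \<Rightarrow> real ^ 'm ^ 'n \<Rightarrow> bool" where
  "stabilizable A B \<longleftrightarrow> (\<exists>K :: real ^ 'n ^ 'm. spec_rad (A - B ** K) < 1)"

definition stab_set :: "real ^ 'n ^ 'n \<Rightarrow> real ^ 'm ^ 'n \<Rightarrow> (real ^ 'n ^ 'm) set" where
  "stab_set A B = {K. spec_rad (A - B ** K) < 1}"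

definition Hinf_cost :: "real ^ 'n ^ 'n \<Rightarrow> real ^ 'm ^ 'n \<Rightarrow> real ^ 'n ^ 'n \<Rightarrow> real ^ 'm ^ 'm
    \<Rightarrow> real ^ 'n ^ 'm \<Rightarrow> real" where
  "Hinf_cost A B Q R K =
     (SUP w \<in> {0..2*pi}.
        sqrt (lambda_max
          (transpose (matrix_inv (mat (exp (- \<i> * complex_of_real w)) - cmat A + cmat B ** cmat K))
           ** cmat (Q + transpose K ** R ** K)
           ** matrix_inv (mat (exp (\<i> * complex_of_real w)) - cmat A + cmat B ** cmat K))))"

definition clarke_subdiff :: "('a::euclidean_space \<Rightarrow> real) \<Rightarrow> 'a set \<Rightarrow> 'a \<Rightarrow> 'a set" where
  "clarke_subdiff J U K = convex hull
     {G. \<exists>Ks Gs. (\<forall>i. Ks i \<in> U \<and> (J has_derivative (\<lambda>H. Gs i \<bullet> H)) (at (Ks i)))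
                 \<and> Ks \<longlonglongrightarrow> K \<and> Gs \<longlonglongrightarrow> G}"

text \<open>Goldstein delta-subdifferential (meaningful when cball K delta is contained in U).\<close>
definition goldstein_subdiff :: "('a::euclidean_space \<Rightarrow> real) \<Rightarrow> 'a set \<Rightarrow> real \<Rightarrow> 'a \<Rightarrow> 'a set" where
  "goldstein_subdiff J U d K = convex hull (\<Union>K' \<in> cball K d. clarke_subdiff J U K')"

definition min_norm_elem :: "'a::real_normed_vector \<Rightarrow> 'a set \<Rightarrow> bool" where
  "min_norm_elem F S \<longleftrightarrow> F \<in> S \<and> (\<forall>G \<in> S. norm F \<le> norm G)"

definition stationary_pt :: "('a::euclidean_space \<Rightarrow> real) \<Rightarrow> 'a set \<Rightarrow> real \<Rightarrow> real \<Rightarrow> 'a \<Rightarrow> bool" where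
  "stationary_pt J U d e K \<longleftrightarrow> infdist 0 (goldstein_subdiff J U d K) \<le> e"

end

theory Submission
  imports Defs
begin

text \<open>
  With \<open>M(\<omega>, K) = e\<^sup>j\<^sup>\<omega> I - A + B K\<close>, the cost \<open>J(K)\<close> is the maximum, over the compact set of pairs
  \<open>(\<omega>, x)\<close> with \<open>|x| = 1\<close>, of the functions \<open>(x\<^sup>* (Q + K\<^sup>T R K) x / |M(\<omega>, K) x|\<^sup>2)\<^sup>1\<^sup>/\<^sup>2\<close>, which are
  smooth in \<open>K\<close>. Hence \<open>J\<close> is locally Lipschitz, and at every point of \<open>\<K>\<close> it is touched from below by
  a differentiable function; so \<open>J\<close> is differentiable wherever it is also touched from above by
  a quadratic. If \<open>J(b) - J(a) > r\<close>, maximising \<open>J(a + t (b - a) + w) - r t - \<mu> |w|\<^sup>2\<close> over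
  \<open>t \<in> [0, 1]\<close> and small \<open>w\<close> produces such points arbitrarily close to the segment, with gradient
  \<open>G = 2 \<mu> w\<close> satisfying \<open>G \<bullet> (b - a) \<ge> r\<close>. Their limits are Clarke subgradients, which replaces
  Rademacher's theorem in the proof of the Goldstein descent inequality
  \<open>J(K - \<delta> F / |F|) \<le> J(K) - \<delta> |F|\<close>. Summing this inequality along the iteration gives the bound.
\<close>

subsection \<open>The Goldstein descent inequality\<close>

text \<open>Let \<open>g\<close> be the quadratic upper bound. Then \<open>g - f\<close> vanishes at
  \<open>y\<close> and has a local minimum there, so \<open>f\<close> and \<open>g\<close> have the
  same derivative at \<open>y\<close>. The difference quotients of \<open>J\<close> are squeezed
  between theirs.\<close>

lemma has_derivative_between:
  fixes J :: "'a::euclidean_space \<Rightarrow> real"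
  assumes f: "(f has_derivative f') (at y)" and fy: "f y = J y"
    and lower: "\<forall>\<^sub>F z in nhds y. f z \<le> J z"
    and upper: "\<forall>\<^sub>F z in nhds y. J z \<le> J y + G \<bullet> (z - y) + \<mu> * (norm (z - y))\<^sup>2"
  shows "(J has_derivative (\<lambda>h. G \<bullet> h)) (at y)"
proof -
  define g where "g = (\<lambda>z. J y + G \<bullet> (z - y) + \<mu> * ((z - y) \<bullet> (z - y)))"
  have g: "(g has_derivative (\<lambda>h. G \<bullet> h)) (at y)"
    unfolding g_def by (auto intro!: derivative_eq_intros)
  have gy: "g y = J y" by (simp add: g_def)
  have upper': "\<forall>\<^sub>F z in nhds y. J z \<le> g z"
    using upper by (simp add: g_def power2_norm_eq_inner)
  have "\<forall>\<^sub>F z in nhds y. g y - f y \<le> g z - f z"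
    using lower upper' by eventually_elim (simp add: fy gy)
  then obtain e where e: "e > 0" "\<And>z. dist z y < e \<Longrightarrow> g y - f y \<le> g z - f z"
    unfolding eventually_nhds_metric by blast
  have "((\<lambda>z. g z - f z) has_derivative (\<lambda>h. G \<bullet> h - f' h)) (at y)"
    by (intro derivative_intros f g)
  then have "(\<lambda>h. G \<bullet> h - f' h) = (\<lambda>h. 0)"
    using e by (intro differential_zero_maxmin[of y "ball y e"]) (auto simp: dist_commute)
  then have f'_eq: "f' = (\<lambda>h. G \<bullet> h)"
    by (auto simp: fun_eq_iff)
  have f_lim: "((\<lambda>z. (f z - f y - G \<bullet> (z - y)) / norm (z - y)) \<longlongrightarrow> 0) (at y)"
    using f unfolding f'_eq has_derivative_at_within by (simp add: divide_inverse mult.commute)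
  have g_lim: "((\<lambda>z. (g z - g y - G \<bullet> (z - y)) / norm (z - y)) \<longlongrightarrow> 0) (at y)"
    using g unfolding has_derivative_at_within by (simp add: divide_inverse mult.commute)
  have lower2: "\<forall>\<^sub>F z in at y. f z \<le> J z" and upper2: "\<forall>\<^sub>F z in at y. J z \<le> g z"
    using lower upper' by (auto simp: eventually_at_filter elim: eventually_mono)
  have "((\<lambda>z. (J z - J y - G \<bullet> (z - y)) / norm (z - y)) \<longlongrightarrow> 0) (at y)"
  proof (rule tendsto_sandwich[OF _ _ f_lim g_lim])
    show "\<forall>\<^sub>F z in at y. (f z - f y - G \<bullet> (z - y)) / norm (z - y)
        \<le> (J z - J y - G \<bullet> (z - y)) / norm (z - y)"
      using lower2 by eventually_elim (auto intro!: divide_right_mono simp: fy)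
    show "\<forall>\<^sub>F z in at y. (J z - J y - G \<bullet> (z - y)) / norm (z - y)
        \<le> (g z - g y - G \<bullet> (z - y)) / norm (z - y)"
      using upper2 by eventually_elim (auto intro!: divide_right_mono simp: gy)
  qed
  then show ?thesis
    unfolding has_derivative_at_within
    by (simp add: divide_inverse mult.commute bounded_linear_inner_right)
qed

text \<open>The pair \<open>(t, w)\<close> maximises \<open>J\<close> along the tube minus the
  linear term \<open>r * t\<close> and the penalty \<open>\<mu> * (norm w)\<^sup>2\<close>.
  Lipschitz continuity keeps \<open>w\<close> interior. Variation of \<open>w\<close> then gives the
  quadratic upper bound, and decreasing \<open>t\<close> while shifting \<open>w\<close> gives the
  slope bound. The maximum may sit at \<open>t = 1\<close>, so only decreases of \<open>t\<close>
  are available.\<close>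

lemma approximate_mean_value:
  fixes J :: "'a::euclidean_space \<Rightarrow> real"
  assumes lip: "L-lipschitz_on C J" and \<eta>: "0 < \<eta>"
    and tube: "\<And>t w. t \<in> {0..1} \<Longrightarrow> norm w \<le> \<eta> \<Longrightarrow> a + t *\<^sub>R (b - a) + w \<in> C"
    and r: "r < J b - J a"
  obtains t w G \<mu> where "t \<in> {0..1}" "norm w < \<eta>" "norm G \<le> 2 * L" "r \<le> G \<bullet> (b - a)"
    "\<forall>\<^sub>F z in nhds (a + t *\<^sub>R (b - a) + w).
       J z \<le> J (a + t *\<^sub>R (b - a) + w) + G \<bullet> (z - (a + t *\<^sub>R (b - a) + w))
             + \<mu> * (norm (z - (a + t *\<^sub>R (b - a) + w)))\<^sup>2"
proof -
  define d where "d = b - a"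
  have L0: "0 \<le> L" using lip by (rule lipschitz_on_nonneg)
  \<comment> \<open>The first summand yields \<open>L / \<mu> < \<eta>\<close>, which keeps the
    maximiser away from the boundary of the tube. The second yields
    \<open>L\<^sup>2 / \<mu> < J b - J a - r\<close>, which rules out \<open>t = 0\<close>. The
    summand 1 keeps \<mu> positive when \<open>L = 0\<close>.\<close>
  define \<mu> where "\<mu> = L / \<eta> + L\<^sup>2 / (J b - J a - r) + 1"
  have \<mu>0: "\<mu> > 0" using L0 \<eta> r by (auto simp: \<mu>_def intro!: add_nonneg_pos)
  have "L / \<eta> < \<mu>" using r by (simp add: \<mu>_def add_nonneg_pos)
  then have \<mu>1: "L / \<mu> < \<eta>" using \<mu>0 \<eta> by (simp add: field_simps)
  have "L\<^sup>2 / (J b - J a - r) < \<mu>" using L0 \<eta> by (simp add: \<mu>_def add_nonneg_pos)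
  then have \<mu>2: "L\<^sup>2 / \<mu> < J b - J a - r" using \<mu>0 r by (simp add: field_simps)
  define \<Phi> where "\<Phi> = (\<lambda>(t, w). J (a + t *\<^sub>R d + w) - r * t - \<mu> * (norm w)\<^sup>2)"
  let ?S = "{0..1::real} \<times> cball (0::'a) \<eta>"
  have tube': "a + t *\<^sub>R d + w \<in> C" if "t \<in> {0..1}" "norm w \<le> \<eta>" for t w
    using tube[OF that] by (simp add: d_def)
  have "continuous_on ?S (\<lambda>p. J (a + fst p *\<^sub>R d + snd p))"
    by (rule continuous_on_compose2[OF lipschitz_on_continuous_on[OF lip]])
       (auto intro!: continuous_intros tube')
  then have "continuous_on ?S \<Phi>"
    unfolding \<Phi>_def case_prod_beta by (intro continuous_intros)
  then obtain p where p: "p \<in> ?S" "\<And>q. q \<in> ?S \<Longrightarrow> \<Phi> q \<le> \<Phi> p"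
    using continuous_attains_sup[of ?S \<Phi>] \<eta> by (auto simp: compact_Times)
  obtain t w where tw: "p = (t, w)" by (cases p)
  have t01: "t \<in> {0..1}" and w\<eta>: "norm w \<le> \<eta>" using p(1) tw by auto
  have max: "J (a + s *\<^sub>R d + v) - r * s - \<mu> * (norm v)\<^sup>2
      \<le> J (a + t *\<^sub>R d + w) - r * t - \<mu> * (norm w)\<^sup>2" if "s \<in> {0..1}" "norm v \<le> \<eta>" for s v
    using p(2)[of "(s, v)"] that by (simp add: \<Phi>_def tw)
  have lip': "J (a + t *\<^sub>R d + w) - J (a + t *\<^sub>R d) \<le> L * norm w"
    using lipschitz_onD[OF lip tube'[OF t01 w\<eta>] tube'[OF t01, of 0]] \<eta>
    by (simp add: dist_norm)
  have "\<mu> * (norm w)\<^sup>2 \<le> L * norm w"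
    using max[OF t01, of 0] \<eta> lip' by simp
  then have "norm w * (\<mu> * norm w) \<le> norm w * L"
    by (simp add: power2_eq_square mult_ac)
  then have \<mu>w: "\<mu> * norm w \<le> L"
    using L0 by (cases "w = 0") auto
  then have w_le: "norm w \<le> L / \<mu>" using \<mu>0 by (simp add: field_simps)
  then have w_less: "norm w < \<eta>" using \<mu>1 by simp
  \<comment> \<open>For \<open>t = 0\<close> the maximum would be at most
    \<open>J a + L\<^sup>2 / \<mu>\<close>, which is below the value \<open>J b - r\<close> taken at
    \<open>(1, 0)\<close>.\<close>
  have t_pos: "0 < t"
  proof (rule ccontr)
    assume "\<not> 0 < t"
    then have [simp]: "t = 0" using t01 by simp
    have "L * norm w \<le> L\<^sup>2 / \<mu>"
      using mult_left_mono[OF w_le L0] by (simp add: power2_eq_square)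
    moreover have "J b - r \<le> J (a + w) - \<mu> * (norm w)\<^sup>2"
      using max[of 1 0] \<eta> by (simp add: d_def)
    moreover have "0 \<le> \<mu> * (norm w)\<^sup>2" using \<mu>0 by simp
    ultimately show False using lip' \<mu>2 by simp
  qed
  define G where "G = (2 * \<mu>) *\<^sub>R w"
  have expand: "\<mu> * (norm (w + v))\<^sup>2 - \<mu> * (norm w)\<^sup>2 = G \<bullet> v + \<mu> * (norm v)\<^sup>2" for v
    unfolding G_def power2_norm_eq_inner by (simp add: algebra_simps inner_commute)
  have "norm G \<le> 2 * L" using \<mu>w \<mu>0 by (simp add: G_def)
  moreover have "r \<le> G \<bullet> d"
  proof (rule field_le_epsilon)
    fix e :: real assume e: "e > 0"
    define k where "k = \<mu> * (norm d)\<^sup>2 + 1"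
    have k: "k > 0" using \<mu>0 by (simp add: k_def add_nonneg_pos)
    \<comment> \<open>Replacing \<open>(t, w)\<close> by \<open>(t - \<tau>, w + \<tau> d)\<close>
      leaves the argument of \<open>J\<close> unchanged, so maximality compares only the linear
      terms and the penalties. The three bounds on \<tau> keep the new parameter nonnegative, keep
      the new shift in the ball, and make the second-order error at most \<open>e\<close>.\<close>
    define \<tau> where "\<tau> = Min {t, (\<eta> - norm w) / (norm d + 1), e / k}"
    have nd: "norm d + 1 > 0" by (simp add: add_nonneg_pos)
    have \<tau>0: "\<tau> > 0" using t_pos w_less e k nd by (simp add: \<tau>_def)
    have \<tau>t: "\<tau> \<le> t" and \<tau>w: "\<tau> \<le> (\<eta> - norm w) / (norm d + 1)" and \<tau>e: "\<tau> \<le> e / k"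
      by (simp_all add: \<tau>_def)
    have "\<tau> * norm d \<le> \<tau> * (norm d + 1)" using \<tau>0 by simp
    also have "\<dots> \<le> \<eta> - norm w" using \<tau>w nd by (simp add: field_simps)
    finally have "norm (w + \<tau> *\<^sub>R d) \<le> \<eta>"
      using norm_triangle_ineq[of w "\<tau> *\<^sub>R d"] \<tau>0 by simp
    moreover have "t - \<tau> \<in> {0..1}" using \<tau>t \<tau>0 t01 by auto
    moreover have "a + (t - \<tau>) *\<^sub>R d + (w + \<tau> *\<^sub>R d) = a + t *\<^sub>R d + w"
      by (simp add: algebra_simps)
    ultimately have "r * \<tau> \<le> \<mu> * (norm (w + \<tau> *\<^sub>R d))\<^sup>2 - \<mu> * (norm w)\<^sup>2"
      using max[of "t - \<tau>" "w + \<tau> *\<^sub>R d"] by (simp add: algebra_simps)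
    also have "\<dots> = \<tau> * (G \<bullet> d + \<tau> * (\<mu> * (norm d)\<^sup>2))"
      unfolding expand by (simp add: algebra_simps power2_eq_square)
    finally have "r \<le> G \<bullet> d + \<tau> * (\<mu> * (norm d)\<^sup>2)" using \<tau>0 by (simp add: mult.commute)
    also have "\<tau> * (\<mu> * (norm d)\<^sup>2) \<le> \<tau> * k" using \<tau>0 by (simp add: k_def)
    also have "\<tau> * k \<le> e" using \<tau>e k by (simp add: field_simps)
    finally show "r \<le> G \<bullet> d + e" by simp
  qed
  \<comment> \<open>With \<open>t\<close> fixed, the shifts around the interior point
    \<open>w\<close> cover a full neighbourhood of the maximising point.\<close>
  moreover have "\<forall>\<^sub>F z in nhds (a + t *\<^sub>R d + w). J z \<le> J (a + t *\<^sub>R d + w)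
      + G \<bullet> (z - (a + t *\<^sub>R d + w)) + \<mu> * (norm (z - (a + t *\<^sub>R d + w)))\<^sup>2"
    unfolding eventually_nhds_metric
  proof (intro exI conjI allI impI)
    show "\<eta> - norm w > 0" using w_less by simp
    fix z assume z: "dist z (a + t *\<^sub>R d + w) < \<eta> - norm w"
    let ?v = "z - (a + t *\<^sub>R d + w)"
    have "norm (w + ?v) \<le> \<eta>"
      using norm_triangle_ineq[of w ?v] z by (simp add: dist_norm)
    from max[OF t01 this] have "J z \<le> J (a + t *\<^sub>R d + w) + (\<mu> * (norm (w + ?v))\<^sup>2 - \<mu> * (norm w)\<^sup>2)"
      by simp
    then show "J z \<le> J (a + t *\<^sub>R d + w) + G \<bullet> ?v + \<mu> * (norm ?v)\<^sup>2"
      unfolding expand by simp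
  qed
  ultimately show ?thesis
    using that t01 w_less unfolding d_def by blast
qed

text \<open>This is the variational inequality of the projection of 0 onto \<open>S\<close>: if it
  failed, a short move from \<open>F\<close> towards \<open>G\<close> would stay in \<open>S\<close>
  by convexity and reduce the norm.\<close>

lemma min_norm_elem_inner_ge:
  fixes F :: "'a::real_inner"
  assumes "convex S" "min_norm_elem F S" "G \<in> S"
  shows "(norm F)\<^sup>2 \<le> G \<bullet> F"
proof (rule ccontr)
  assume "\<not> ?thesis"
  then have "(0 - F) \<bullet> (G - F) > 0"
    by (simp add: algebra_simps power2_norm_eq_inner inner_commute)
  then obtain u where u: "u > 0" "u \<le> 1" "dist (F + u *\<^sub>R (G - F)) 0 < dist F 0"
    using closer_point_lemma[of 0 F G] by blast
  have "F + u *\<^sub>R (G - F) = (1 - u) *\<^sub>R F + u *\<^sub>R G" by (simp add: algebra_simps)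
  also have "\<dots> \<in> S" using assms u by (intro convexD) (auto simp: min_norm_elem_def)
  finally show False using assms(2) u(3) by (force simp: min_norm_elem_def)
qed

lemma clarke_subset_goldstein:
  "K' \<in> cball K d \<Longrightarrow> clarke_subdiff J U K' \<subseteq> goldstein_subdiff J U d K"
  unfolding goldstein_subdiff_def by (rule order_trans[OF _ hull_subset]) blast

text \<open>If the decrease were too small, tubes shrinking to the segment would contain
  differentiability points whose gradients have inner product at least \<open>r\<close> with
  \<open>b - x\<close>. By compactness a subsequence converges, and its limit is a Goldstein
  subgradient contradicting the variational inequality for \<open>F\<close>. Hypothesis
  \<open>sub\<close> supplies the function touching \<open>J\<close> from below.\<close>

lemma goldstein_descent:
  fixes J :: "'a::euclidean_space \<Rightarrow> real"
  assumes lip: "\<And>C. compact C \<Longrightarrow> convex C \<Longrightarrow> C \<subseteq> U \<Longrightarrow> \<exists>L. L-lipschitz_on C J"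
    and sub: "\<And>y. y \<in> U \<Longrightarrow> \<exists>f f'. (f has_derivative f') (at y) \<and> f y = J y \<and> (\<forall>z\<in>U. f z \<le> J z)"
    and ball: "ball x \<rho> \<subseteq> U" and \<delta>: "0 < \<delta>" "\<delta> < \<rho>"
    and F: "min_norm_elem F (goldstein_subdiff J U \<delta> x)"
  shows "J (x - (\<delta> / norm F) *\<^sub>R F) \<le> J x - \<delta> * norm F"
proof (cases "F = 0")
  case False
  define b where "b = x - (\<delta> / norm F) *\<^sub>R F"
  have dist_b: "norm (b - x) = \<delta>" using False \<delta> by (simp add: b_def)
  \<comment> \<open>Half of the slack between \<delta> and \<rho>: the closed ball of radius
    \<open>\<delta> + \<eta>\<close> still lies in \<open>U\<close>, and being compact and convex it
    carries a Lipschitz constant.\<close>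
  define \<eta> where "\<eta> = (\<rho> - \<delta>) / 2"
  have \<eta>: "\<eta> > 0" "\<delta> + \<eta> < \<rho>" using \<delta> by (simp_all add: \<eta>_def field_simps)
  have C: "cball x (\<delta> + \<eta>) \<subseteq> U" using ball \<eta> by (auto simp: subset_iff)
  obtain L where L: "L-lipschitz_on (cball x (\<delta> + \<eta>)) J"
    using lip[OF compact_cball convex_cball C] by blast
  have dist_tube: "dist x (x + t *\<^sub>R (b - x) + w) \<le> \<delta> + e" if "t \<in> {0..1}" "norm w \<le> e" for t w e
  proof -
    have "dist x (x + t *\<^sub>R (b - x) + w) = norm (t *\<^sub>R (b - x) + w)"
      unfolding dist_commute[of x] by (simp add: dist_norm add.assoc)
    also have "\<dots> \<le> t * \<delta> + norm w"
      using norm_triangle_ineq[of "t *\<^sub>R (b - x)" w] that by (simp add: dist_b)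
    also have "t * \<delta> \<le> \<delta>" using that \<delta> by (simp add: mult_left_le_one_le)
    finally show ?thesis using that by simp
  qed
  have "J b - J x \<le> - \<delta> * norm F"
  proof (rule ccontr)
    assume "\<not> ?thesis"
    then obtain r where r: "- \<delta> * norm F < r" "r < J b - J x"
      using dense by (meson not_le)
    \<comment> \<open>The tube radius tends to 0 with \<open>k\<close>, so that every limit of the
      points \<open>y\<close> lies in the closed \<delta>-ball, where Goldstein subgradients are
      collected.\<close>
    have "\<exists>y G. dist x y \<le> \<delta> + \<eta> / real (Suc k) \<and> norm G \<le> 2 * L \<and> r \<le> G \<bullet> (b - x)
        \<and> (J has_derivative (\<lambda>h. G \<bullet> h)) (at y)" for k
    proof -
      have \<eta>k: "\<eta> / real (Suc k) > 0" "\<eta> / real (Suc k) \<le> \<eta>"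
        using \<eta> by (simp_all add: field_simps)
      have tube: "x + t *\<^sub>R (b - x) + w \<in> cball x (\<delta> + \<eta>)"
        if "t \<in> {0..1}" "norm w \<le> \<eta> / real (Suc k)" for t w
        using dist_tube[OF that] \<eta>k(2) unfolding mem_cball by linarith
      obtain t w G \<mu> where t: "t \<in> {0..1}" and w: "norm w < \<eta> / real (Suc k)"
        and G: "norm G \<le> 2 * L" "r \<le> G \<bullet> (b - x)"
        and up: "\<forall>\<^sub>F z in nhds (x + t *\<^sub>R (b - x) + w).
           J z \<le> J (x + t *\<^sub>R (b - x) + w) + G \<bullet> (z - (x + t *\<^sub>R (b - x) + w))
             + \<mu> * (norm (z - (x + t *\<^sub>R (b - x) + w)))\<^sup>2"
        by (rule approximate_mean_value[OF L \<eta>k(1) tube r(2)])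
      define y where "y = x + t *\<^sub>R (b - x) + w"
      have y: "dist x y \<le> \<delta> + \<eta> / real (Suc k)"
        unfolding y_def by (rule dist_tube) (use t w in auto)
      then have y\<rho>: "y \<in> ball x \<rho>" using \<eta> \<eta>k by simp
      then obtain f f' where f: "(f has_derivative f') (at y)" "f y = J y" "\<forall>z\<in>U. f z \<le> J z"
        using sub[of y] ball by blast
      have "\<forall>\<^sub>F z in nhds y. z \<in> ball x \<rho>"
        using y\<rho> by (intro eventually_nhds_in_open) auto
      then have "\<forall>\<^sub>F z in nhds y. f z \<le> J z"
        by (rule eventually_mono) (use f(3) ball in blast)
      then have "(J has_derivative (\<lambda>h. G \<bullet> h)) (at y)"
        using f up unfolding y_def[symmetric] by (intro has_derivative_between) auto
      with y G show ?thesis by blast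
    qed
    then obtain y G where y: "\<And>k. dist x (y k) \<le> \<delta> + \<eta> / real (Suc k)"
      and G: "\<And>k. norm (G k) \<le> 2 * L" "\<And>k. r \<le> G k \<bullet> (b - x)"
      and J': "\<And>k. (J has_derivative (\<lambda>h. G k \<bullet> h)) (at (y k))"
      by metis
    have y\<eta>: "dist x (y k) \<le> \<delta> + \<eta>" for k
    proof -
      have "\<eta> / real (Suc k) \<le> \<eta>" using \<eta> by (simp add: field_simps)
      with y[of k] show ?thesis by linarith
    qed
    have "seq_compact (cball x (\<delta> + \<eta>) \<times> cball (0::'a) (2 * L))"
      by (intro compact_imp_seq_compact compact_Times compact_cball)
    moreover have "\<forall>k. (y k, G k) \<in> cball x (\<delta> + \<eta>) \<times> cball 0 (2 * L)"
      using y\<eta> G(1) by auto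
    ultimately obtain l s where s: "strict_mono s" "((\<lambda>k. (y k, G k)) \<circ> s) \<longlonglongrightarrow> l"
      by (rule seq_compactE)
    define y' G' where "y' = fst l" "G' = snd l"
    have y': "(y \<circ> s) \<longlonglongrightarrow> y'" and G': "(G \<circ> s) \<longlonglongrightarrow> G'"
      using tendsto_fst[OF s(2)] tendsto_snd[OF s(2)] by (simp_all add: y'_G'_def o_def)
    have "(y \<circ> s) k \<in> U" for k using y\<eta>[of "s k"] C by (auto simp: subset_iff)
    moreover have "(J has_derivative (\<lambda>h. (G \<circ> s) k \<bullet> h)) (at ((y \<circ> s) k))" for k
      unfolding o_def by (rule J')
    ultimately have "G' \<in> clarke_subdiff J U y'"
      unfolding clarke_subdiff_def using y' G' by (intro hull_inc) blast
    moreover have "dist x y' \<le> \<delta>"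
    proof (rule LIMSEQ_le)
      show "(\<lambda>k. dist x ((y \<circ> s) k)) \<longlonglongrightarrow> dist x y'" by (intro tendsto_intros y')
      have "(\<lambda>k. \<delta> + \<eta> / real (Suc k)) \<longlonglongrightarrow> \<delta> + 0"
        by (intro tendsto_intros LIMSEQ_Suc lim_const_over_n)
      from LIMSEQ_subseq_LIMSEQ[OF this s(1)]
      show "((\<lambda>k. \<delta> + \<eta> / real (Suc k)) \<circ> s) \<longlonglongrightarrow> \<delta>" by simp
    qed (use y in auto)
    ultimately have "G' \<in> goldstein_subdiff J U \<delta> x"
      using clarke_subset_goldstein by fastforce
    then have "(norm F)\<^sup>2 \<le> G' \<bullet> F"
      using F by (intro min_norm_elem_inner_ge) (auto simp: goldstein_subdiff_def)
    \<comment> \<open>The factor turns \<open>F\<close> into \<open>x - b\<close>, so the inequality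
      becomes an upper bound on \<open>G' \<bullet> (b - x)\<close>.\<close>
    then have "(\<delta> / norm F) * (norm F)\<^sup>2 \<le> (\<delta> / norm F) * (G' \<bullet> F)"
      using \<delta> by (intro mult_left_mono) auto
    then have "\<delta> * norm F \<le> - (G' \<bullet> (b - x))"
      using False by (simp add: b_def power2_eq_square)
    moreover have "r \<le> G' \<bullet> (b - x)"
      using G(2) by (intro LIMSEQ_le_const[OF tendsto_inner[OF G' tendsto_const]]) auto
    ultimately show False using r by simp
  qed
  then show ?thesis by (simp add: b_def)
\<comment> \<open>For \<open>F = 0\<close> the step vanishes and both sides equal
  \<open>J x\<close>.\<close>
qed (simp add: assms)

text \<open>Descent keeps every iterate in the initial sublevel set. The ball around it whose radius
  is the distance from that set to the complement therefore lies in \<open>U\<close>, and as this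
  radius exceeds \<delta>, the next step stays in \<open>U\<close> and the descent inequality
  applies again.\<close>

lemma goldstein_method_bound:
  fixes J :: "'a::euclidean_space \<Rightarrow> real" and K F :: "nat \<Rightarrow> 'a"
  assumes lip: "\<And>C. compact C \<Longrightarrow> convex C \<Longrightarrow> C \<subseteq> U \<Longrightarrow> \<exists>L. L-lipschitz_on C J"
    and sub: "\<And>y. y \<in> U \<Longrightarrow> \<exists>f f'. (f has_derivative f') (at y) \<and> f y = J y \<and> (\<forall>z\<in>U. f z \<le> J z)"
    and K0: "K 0 \<in> U"
    and \<delta>: "0 < \<delta>" "\<delta> < setdist {x \<in> U. J x \<le> J (K 0)} (- U)"
    and F: "\<And>n. min_norm_elem (F n) (goldstein_subdiff J U \<delta> (K n))"
    and step: "\<And>n. K (Suc n) = K n - (\<delta> / norm (F n)) *\<^sub>R F n"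
  shows "K n \<in> U \<and> J (K n) + \<delta> * (\<Sum>i<n. norm (F i)) \<le> J (K 0)"
proof (induction n)
  case 0
  then show ?case using K0 by simp
next
  case (Suc n)
  let ?\<rho> = "setdist {x \<in> U. J x \<le> J (K 0)} (- U)"
  have "0 \<le> \<delta> * (\<Sum>i<n. norm (F i))" using \<delta> by (simp add: sum_nonneg)
  then have Kn: "K n \<in> {x \<in> U. J x \<le> J (K 0)}" using Suc by simp
  have ball: "ball (K n) ?\<rho> \<subseteq> U"
  proof
    fix z assume z: "z \<in> ball (K n) ?\<rho>"
    show "z \<in> U"
    proof (rule ccontr)
      assume "z \<notin> U"
      then have "?\<rho> \<le> dist (K n) z" using Kn by (intro setdist_le_dist) auto
      with z show False by simp
    qed
  qed
  have "dist (K n) (K (Suc n)) \<le> \<delta>" using \<delta> by (simp add: step dist_norm)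
  then have "K (Suc n) \<in> U" using ball \<delta> by (auto simp: subset_iff)
  moreover have "J (K (Suc n)) \<le> J (K n) - \<delta> * norm (F n)"
    unfolding step by (rule goldstein_descent[OF lip sub ball \<delta> F])
  ultimately show ?case using Suc by (simp add: algebra_simps)
qed

subsection \<open>The cost as a maximum of smooth functions\<close>

text \<open>Compactness bounds all the derivatives by one \<open>L\<close>, and convexity of
  \<open>C\<close> turns this into a common Lipschitz constant. To bound \<open>J x - J y\<close>,
  choose the member attaining \<open>J x\<close>; at \<open>y\<close> it lies below
  \<open>J y\<close>.\<close>

lemma max_of_smooth_family_lipschitz:
  fixes h :: "'p::metric_space \<Rightarrow> 'a::euclidean_space \<Rightarrow> real"
  assumes P: "compact P" and C: "compact C" "convex C"
    and deriv: "\<And>p x. p \<in> P \<Longrightarrow> x \<in> C \<Longrightarrow> (h p has_derivative h' p x) (at x)"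
    and cont: "continuous_on (P \<times> C \<times> sphere 0 1) (\<lambda>(p, x, v). h' p x v)"
    and le: "\<And>p x. p \<in> P \<Longrightarrow> x \<in> C \<Longrightarrow> h p x \<le> J x"
    and attained: "\<And>x. x \<in> C \<Longrightarrow> \<exists>p\<in>P. J x = h p x"
  shows "\<exists>L. L-lipschitz_on C J"
proof -
  have "bounded ((\<lambda>(p, x, v). h' p x v) ` (P \<times> C \<times> sphere 0 1))"
    by (intro compact_imp_bounded compact_continuous_image cont compact_Times P C compact_sphere)
  then obtain L where L: "L > 0" "\<And>p x v. p \<in> P \<Longrightarrow> x \<in> C \<Longrightarrow> norm v = 1 \<Longrightarrow> \<bar>h' p x v\<bar> \<le> L"
    unfolding bounded_pos by fastforce
  have h_lip: "L-lipschitz_on C (h p)" if p: "p \<in> P" for p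
  proof (rule bounded_derivative_imp_lipschitz[OF _ C(2)])
    fix x assume x: "x \<in> C"
    show "(h p has_derivative h' p x) (at x within C)"
      using deriv[OF p x] by (rule has_derivative_at_withinI)
    have lin: "linear (h' p x)" using deriv[OF p x] by (rule has_derivative_linear)
    show "onorm (h' p x) \<le> L"
    proof (rule onorm_le)
      fix v
      show "norm (h' p x v) \<le> L * norm v"
      proof (cases "v = 0")
        case False
        \<comment> \<open>The bound is known for unit directions; linearity of the derivative
          extends it to all.\<close>
        have "\<bar>h' p x (v /\<^sub>R norm v)\<bar> \<le> L" by (rule L(2)[OF p x]) (use False in simp)
        then show ?thesis using False by (simp add: linear_scale[OF lin] field_simps abs_mult)
      qed (simp add: linear_0[OF lin])
    qed
  qed (use L in simp)
  have half: "J x - J y \<le> L * dist x y" if x: "x \<in> C" and y: "y \<in> C" for x y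
  proof -
    obtain p where p: "p \<in> P" "J x = h p x" using attained[OF x] by blast
    have "h p x - h p y \<le> L * dist x y"
      using lipschitz_onD[OF h_lip[OF p(1)] x y] by (simp add: dist_real_def)
    with p le[OF p(1) y] show ?thesis by simp
  qed
  have "L-lipschitz_on C J"
  proof (rule lipschitz_onI)
    fix x y assume "x \<in> C" "y \<in> C"
    then show "dist (J x) (J y) \<le> L * dist x y"
      using half[of x y] half[of y x] by (simp add: dist_real_def abs_le_iff dist_commute)
  qed (use L in simp)
  then show ?thesis by blast
qed

section \<open>Complex matrices and vectors under the real inner product\<close>

text \<open>The inner product on \<open>complex ^ 'n\<close> is the real part of the Hermitian one,
  and the adjoint for it is still the conjugate transpose.\<close>

lemma inner_adjoint_complex:
  fixes M :: "complex ^ 'n ^ 'm"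
  shows "(M *v x) \<bullet> y = x \<bullet> ((\<chi> i j. cnj (M $ j $ i)) *v y)"
proof -
  have *: "(a * b) \<bullet> c = b \<bullet> (cnj a * c)" for a b c :: complex
    by (simp add: inner_complex_def algebra_simps)
  have "(M *v x) \<bullet> y = (\<Sum>i\<in>UNIV. \<Sum>j\<in>UNIV. (M $ i $ j * x $ j) \<bullet> (y $ i))"
    by (simp add: inner_vec_def matrix_vector_mult_def inner_sum_left)
  also have "\<dots> = (\<Sum>j\<in>UNIV. \<Sum>i\<in>UNIV. (x $ j) \<bullet> (cnj (M $ i $ j) * y $ i))"
    unfolding * by (rule sum.swap)
  also have "\<dots> = x \<bullet> ((\<chi> i j. cnj (M $ j $ i)) *v y)"
    by (simp add: inner_vec_def matrix_vector_mult_def inner_sum_right)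
  finally show ?thesis .
qed

lemma inner_adjoint_cmat: "(cmat M *v x) \<bullet> y = x \<bullet> (cmat (transpose M) *v y)"
proof -
  have "(\<chi> i j. cnj (cmat M $ j $ i)) = cmat (transpose M)"
    by (simp add: vec_eq_iff cmat_def transpose_def)
  then show ?thesis using inner_adjoint_complex[of "cmat M" x y] by simp
qed

lemma cmat_add: "cmat (M + N) = cmat M + cmat N"
  by (simp add: cmat_def vec_eq_iff)

lemma cmat_diff: "cmat (M - N) = cmat M - cmat N"
  by (simp add: cmat_def vec_eq_iff)

lemma cmat_mult: "cmat (M ** N) = cmat M ** cmat N"
  by (simp add: cmat_def vec_eq_iff matrix_matrix_mult_def)

lemma transpose_add: "transpose (M + N) = transpose M + transpose N"
  by (simp add: transpose_def vec_eq_iff)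

lemma mat_mult_vec: "mat c *v x = c *s (x :: 'a::comm_semiring_1 ^ 'n)"
  by (simp add: mat_def matrix_vector_mult_def vec_eq_iff if_distrib[where f="\<lambda>a. a * _"] cong: if_cong)

lemma norm_complex_scalar_mult: "norm (c *s (x :: complex ^ 'n)) = cmod c * norm x"
  by (simp add: norm_vec_def norm_mult L2_set_right_distrib)

text \<open>Multiplication by the imaginary unit sends \<open>x\<close> to a vector orthogonal to it
  in the real inner product, so only \<open>Re c\<close> survives.\<close>

lemma inner_complex_scalar_mult_self: "x \<bullet> (c *s (x :: complex ^ 'n)) = Re c * (norm x)\<^sup>2"
  by (simp add: power2_norm_eq_inner inner_vec_def inner_complex_def sum_distrib_left algebra_simps)

text \<open>Gives access to the continuity and derivative rules for products, with the real gain and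
  the complex vector as factors.\<close>

lemma bounded_bilinear_cmat_mult_vec:
  "bounded_bilinear (\<lambda>(M :: real ^ 'n ^ 'm) (x :: complex ^ 'n). cmat M *v x)"
  unfolding bilinear_conv_bounded_bilinear[symmetric]
  by (auto simp: bilinear_def cmat_def matrix_vector_mult_def vec_eq_iff sum.distrib
      scaleR_sum_right scaleR_conv_of_real[where 'a=complex] sum_distrib_left algebra_simps intro!: linearI)

text \<open>For a real matrix the form splits into its values at the real and imaginary parts of
  \<open>x\<close>, at least one of which is nonzero.\<close>

lemma cmat_pos:
  assumes "sym_pos_def M" "x \<noteq> 0"
  shows "0 < x \<bullet> (cmat M *v x)"
proof -
  define u v where "u = (\<chi> i. Re (x $ i))" and "v = (\<chi> i. Im (x $ i))"
  have "x \<bullet> (cmat M *v x) = u \<bullet> (M *v u) + v \<bullet> (M *v v)"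
    by (simp add: u_def v_def inner_vec_def inner_complex_def matrix_vector_mult_def cmat_def sum.distrib)
  moreover have "u \<noteq> 0 \<or> v \<noteq> 0"
    using assms(2) by (auto simp: u_def v_def vec_eq_iff complex_eq_iff)
  moreover have "0 \<le> z \<bullet> (M *v z)" for z
    using assms(1) by (cases "z = 0") (auto simp: sym_pos_def_def less_imp_le)
  moreover have "0 < z \<bullet> (M *v z)" if "z \<noteq> 0" for z
    using assms(1) that by (auto simp: sym_pos_def_def)
  ultimately show ?thesis by (metis add_nonneg_pos add_pos_nonneg)
qed

text \<open>The point is that the set under \<open>Sup\<close> is bounded above; the operator norm
  is a bound.\<close>

lemma eigenvalue_le_spec_rad:
  assumes "is_eigenvalue (cmat M) l"
  shows "cmod l \<le> spec_rad M"
  unfolding spec_rad_def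
proof (rule cSup_upper)
  show "bdd_above {cmod l |l. is_eigenvalue (cmat M) l}"
  proof (rule bdd_aboveI, clarify)
    fix l assume "is_eigenvalue (cmat M) l"
    then obtain v where v: "v \<noteq> 0" "cmat M *v v = l *s v" unfolding is_eigenvalue_def by blast
    have "cmod l * norm v \<le> onorm ((*v) (cmat M)) * norm v"
      using onorm[OF matrix_vector_mul_bounded_linear, of "cmat M" v] v(2)
      by (simp add: norm_complex_scalar_mult)
    then show "cmod l \<le> onorm ((*v) (cmat M))" using v(1) by simp
  qed
qed (use assms in blast)

section \<open>The closed loop, its Rayleigh quotients and the attained supremum\<close>

text \<open>Acting on a vector rather than being a matrix, it is assembled from bilinear pieces,
  which makes joint continuity and differentiation in the gain direct.\<close>

definition closed_loop :: "real ^ 'n ^ 'n \<Rightarrow> real ^ 'm ^ 'n \<Rightarrow> real \<Rightarrow> real ^ 'n ^ 'm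
    \<Rightarrow> complex ^ 'n \<Rightarrow> complex ^ 'n" where
  "closed_loop A B w K x = exp (\<i> * complex_of_real w) *s x - cmat A *v x + cmat B *v (cmat K *v x)"

definition stage_cost :: "real ^ 'n ^ 'n \<Rightarrow> real ^ 'm ^ 'm \<Rightarrow> real ^ 'n ^ 'm \<Rightarrow> complex ^ 'n \<Rightarrow> real" where
  "stage_cost Q R K x = x \<bullet> (cmat Q *v x) + (cmat K *v x) \<bullet> (cmat R *v (cmat K *v x))"

lemma closed_loop_eq:
  "(mat (exp (\<i> * complex_of_real w)) - cmat A + cmat B ** cmat K) *v x = closed_loop A B w K x"
  by (simp add: closed_loop_def matrix_vector_mult_add_rdistrib matrix_vector_mult_diff_rdistrib
      mat_mult_vec matrix_vector_mul_assoc)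

lemma stage_cost_eq: "x \<bullet> (cmat (Q + transpose K ** R ** K) *v x) = stage_cost Q R K x"
  by (simp add: stage_cost_def cmat_add cmat_mult matrix_vector_mult_add_rdistrib inner_add_right
      matrix_vector_mul_assoc[symmetric] inner_adjoint_cmat[of K x])

lemma stage_cost_pos:
  assumes "sym_pos_def Q" "sym_pos_def R" "x \<noteq> 0"
  shows "0 < stage_cost Q R K x"
proof (cases "cmat K *v x = 0")
  case True
  then show ?thesis using cmat_pos[OF assms(1,3)] by (simp add: stage_cost_def)
next
  case False
  then show ?thesis
    using cmat_pos[OF assms(1,3)] cmat_pos[OF assms(2) False] by (simp add: stage_cost_def)
qed

text \<open>A kernel vector would be an eigenvector of \<open>A - B ** K\<close> with an eigenvalue
  on the unit circle.\<close>

lemma closed_loop_nonzero: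
  assumes "K \<in> stab_set A B" "x \<noteq> 0"
  shows "closed_loop A B w K x \<noteq> 0"
proof
  let ?l = "exp (\<i> * complex_of_real w)"
  assume "closed_loop A B w K x = 0"
  then have "cmat (A - B ** K) *v x = ?l *s x"
    by (simp add: closed_loop_def cmat_diff cmat_mult matrix_vector_mult_diff_rdistrib
        matrix_vector_mul_assoc algebra_simps)
  then have "is_eigenvalue (cmat (A - B ** K)) ?l"
    using assms(2) unfolding is_eigenvalue_def by blast
  then have "cmod ?l \<le> spec_rad (A - B ** K)" by (rule eigenvalue_le_spec_rad)
  then show False using assms(1) by (simp add: stab_set_def)
qed

text \<open>Substituting \<open>v = M x\<close> turns the Rayleigh quotient of \<open>M\<^sup>-\<^sup>* S M\<^sup>-\<^sup>1\<close> at \<open>v\<close> into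
  the generalised Rayleigh quotient of the pair \<open>(S, M\<^sup>* M)\<close> at \<open>x\<close>, which involves no inverse.\<close>

lemma lambda_max_congruence:
  fixes M M' S :: "complex ^ 'n ^ 'n"
  assumes M: "\<And>x. x \<noteq> 0 \<Longrightarrow> M *v x \<noteq> 0"
    and M': "\<And>x. x \<noteq> 0 \<Longrightarrow> M' *v x \<noteq> 0"
    and adj: "\<And>x y. (M *v x) \<bullet> y = x \<bullet> (transpose M' *v y)"
    and S: "\<And>x y. (S *v x) \<bullet> y = x \<bullet> (S *v y)"
  defines "H \<equiv> transpose (matrix_inv M') ** S ** matrix_inv M"
  shows "\<exists>x\<in>sphere 0 1. lambda_max H = x \<bullet> (S *v x) / (norm (M *v x))\<^sup>2"
    and "x \<noteq> 0 \<Longrightarrow> x \<bullet> (S *v x) / (norm (M *v x))\<^sup>2 \<le> lambda_max H"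
proof -
  have inv: "invertible N" if "\<And>x. x \<noteq> 0 \<Longrightarrow> N *v x \<noteq> 0" for N :: "complex ^ 'n ^ 'n"
    using that unfolding invertible_left_inverse matrix_left_invertible_ker by blast
  have matrix_inv: "N ** matrix_inv N = mat 1 \<and> matrix_inv N ** N = mat 1" if "invertible N" for N :: "complex ^ 'n ^ 'n"
    using that unfolding matrix_inv_def invertible_def by (rule someI_ex)
  have Minv: "matrix_inv M ** M = mat 1" "M ** matrix_inv M = mat 1"
    and M'inv: "matrix_inv M' ** M' = mat 1"
    using matrix_inv[OF inv[OF M]] matrix_inv[OF inv[OF M']] by auto
  \<comment> \<open>By \<open>adj\<close>, \<open>transpose M'\<close> is the adjoint of
    \<open>M\<close>, so \<open>T\<close> is the inverse of that adjoint.\<close>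
  define T where "T = transpose (matrix_inv M')"
  have TM': "transpose M' ** T = mat 1"
    using arg_cong[OF M'inv, of transpose] by (simp add: T_def matrix_transpose_mul transpose_mat)
  then have TM: "T ** transpose M' = mat 1" using matrix_left_right_inverse by blast
  have adjT: "(M *v x) \<bullet> (T *v y) = x \<bullet> y" for x y
    by (simp add: adj matrix_vector_mul_assoc TM')
  have H_M: "H *v (M *v x) = T *v (S *v x)" for x
  proof -
    have "H *v (M *v x) = (T ** S) *v ((matrix_inv M ** M) *v x)"
      by (simp only: H_def T_def matrix_vector_mul_assoc matrix_mul_assoc)
    then show ?thesis by (simp add: Minv matrix_vector_mul_assoc)
  qed
  define q where "q = (\<lambda>x. x \<bullet> (S *v x) / (norm (M *v x))\<^sup>2)"
  have lin: "continuous_on X ((*v) N)" for X and N :: "complex ^ 'n ^ 'n"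
    by (intro linear_continuous_on matrix_vector_mul_bounded_linear)
  have "(norm (M *v x))\<^sup>2 \<noteq> 0" if "x \<in> sphere 0 1" for x
  proof -
    have "x \<noteq> 0" using that by auto
    then show ?thesis using M[of x] by simp
  qed
  then have "continuous_on (sphere 0 1) q"
    unfolding q_def by (intro continuous_on_divide continuous_on_inner continuous_on_power
        continuous_on_norm continuous_on_id lin) blast
  moreover have "sphere (0 :: complex ^ 'n) 1 \<noteq> {}" by simp
  ultimately obtain x0 where x0: "x0 \<in> sphere 0 1" "\<And>x. x \<in> sphere 0 1 \<Longrightarrow> q x \<le> q x0"
    using continuous_attains_sup[OF compact_sphere] by metis
  define \<mu> where "\<mu> = q x0"
  have scale: "N *v (c *\<^sub>R x) = c *\<^sub>R (N *v x)" for N :: "complex ^ 'n ^ 'n" and c x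
    by (rule linear_scale[OF bounded_linear.linear[OF matrix_vector_mul_bounded_linear]])
  have q_scale: "q (c *\<^sub>R x) = q x" if "c \<noteq> 0" for c x
    using that by (simp add: q_def scale power_mult_distrib) (simp add: power2_eq_square)
  have q_le: "q x \<le> \<mu>" if "x \<noteq> 0" for x
    using x0(2)[of "x /\<^sub>R norm x"] that q_scale[of "inverse (norm x)" x] by (simp add: \<mu>_def)
  have form_nonneg: "0 \<le> \<mu> * (norm (M *v x))\<^sup>2 - x \<bullet> (S *v x)" for x
    using q_le[of x] M[of x] by (cases "x = 0") (auto simp: q_def field_simps)
  have x0_nz: "x0 \<noteq> 0" using x0(1) by auto
  then have form_zero: "\<mu> * (norm (M *v x0))\<^sup>2 - x0 \<bullet> (S *v x0) = 0"
    using M[of x0] by (simp add: \<mu>_def q_def)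
  \<comment> \<open>The form \<mu> |Mx|^2 - x . Sx is nonnegative and vanishes at \<open>x0\<close>.
    Along the line through \<open>x0\<close> in direction \<open>y\<close> it is a quadratic in
    \<open>t\<close> without constant term, minimal at 0, so its linear coefficient
    vanishes.\<close>
  have crit: "\<mu> * ((M *v x0) \<bullet> (M *v y)) = y \<bullet> (S *v x0)" for y
  proof -
    define \<phi> where "\<phi> = (\<lambda>t. \<mu> * (norm (M *v (x0 + t *\<^sub>R y)))\<^sup>2 - (x0 + t *\<^sub>R y) \<bullet> (S *v (x0 + t *\<^sub>R y)))"
    define c where "c = 2 * (\<mu> * ((M *v x0) \<bullet> (M *v y)) - y \<bullet> (S *v x0))"
    define e where "e = \<mu> * (norm (M *v y))\<^sup>2 - y \<bullet> (S *v y)"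
    have "\<phi> = (\<lambda>t. t * c + t * t * e)"
    proof
      fix t
      have "x0 \<bullet> (S *v y) = y \<bullet> (S *v x0)" using S[of x0 y] by (simp add: inner_commute)
      then have "\<phi> t = \<mu> * (norm (M *v x0))\<^sup>2 - x0 \<bullet> (S *v x0) + t * c + t * t * e"
        unfolding \<phi>_def c_def e_def power2_norm_eq_inner
        by (simp add: matrix_vector_right_distrib scale inner_add_left
            inner_add_right inner_commute algebra_simps)
      then show "\<phi> t = t * c + t * t * e" using form_zero by simp
    qed
    then have "(\<phi> has_real_derivative c) (at 0)" by (auto intro!: derivative_eq_intros)
    moreover have "\<phi> 0 \<le> \<phi> t" for t
      using form_nonneg[of "x0 + t *\<^sub>R y"] form_zero by (simp add: \<phi>_def)
    ultimately have "c = 0" by (intro DERIV_local_min[of \<phi> c 0 1]) auto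
    then show ?thesis by (simp add: c_def)
  qed
  \<comment> \<open>Criticality in every direction \<open>y\<close> is a vector equation; applying
    \<open>T\<close> to it makes \<open>M *v x0\<close> an eigenvector of \<open>H\<close> with
    eigenvalue \<mu>.\<close>
  have "transpose M' *v (\<mu> *\<^sub>R (M *v x0)) = S *v x0"
  proof (rule vector_eq_rdot[THEN iffD1], rule allI)
    fix y
    show "(transpose M' *v (\<mu> *\<^sub>R (M *v x0))) \<bullet> y = (S *v x0) \<bullet> y"
      using adj[of y "\<mu> *\<^sub>R (M *v x0)"] crit[of y] by (simp add: inner_commute)
  qed
  then have "T *v (S *v x0) = \<mu> *\<^sub>R (M *v x0)"
    using TM by (metis matrix_vector_mul_assoc matrix_vector_mul_lid)
  then have "H *v (M *v x0) = complex_of_real \<mu> *s (M *v x0)"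
    by (simp add: H_M vec_eq_iff scaleR_conv_of_real[where 'a=complex])
  then have eig: "is_eigenvalue H (complex_of_real \<mu>)"
    using M[OF x0_nz] unfolding is_eigenvalue_def by blast
  have eig_le: "Re l \<le> \<mu>" if l: "is_eigenvalue H l" for l
  proof -
    obtain v where v: "v \<noteq> 0" "H *v v = l *s v" using l unfolding is_eigenvalue_def by blast
    define x where "x = matrix_inv M *v v"
    have Mx: "M *v x = v" by (simp add: x_def matrix_vector_mul_assoc Minv)
    then have x_nz: "x \<noteq> 0" using v by auto
    have "x \<bullet> (S *v x) = (M *v x) \<bullet> (H *v (M *v x))" by (simp add: H_M adjT)
    also have "\<dots> = Re l * (norm (M *v x))\<^sup>2"
      by (simp add: Mx v inner_complex_scalar_mult_self)
    finally have "q x = Re l" using v by (simp add: q_def Mx)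
    then show ?thesis using q_le[OF x_nz] by simp
  qed
  have "lambda_max H = \<mu>"
    unfolding lambda_max_def
    by (rule cSup_eq_maximum) (use eig eig_le in \<open>auto intro!: exI[of _ "complex_of_real \<mu>"]\<close>)
  then show "\<exists>x\<in>sphere 0 1. lambda_max H = x \<bullet> (S *v x) / (norm (M *v x))\<^sup>2"
    and "x \<noteq> 0 \<Longrightarrow> x \<bullet> (S *v x) / (norm (M *v x))\<^sup>2 \<le> lambda_max H"
    using x0(1) q_le[of x] by (auto simp: \<mu>_def q_def)
qed

definition gain :: "real ^ 'n ^ 'n \<Rightarrow> real ^ 'm ^ 'n \<Rightarrow> real ^ 'n ^ 'n \<Rightarrow> real ^ 'm ^ 'm
    \<Rightarrow> real \<times> (complex ^ 'n) \<Rightarrow> real ^ 'n ^ 'm \<Rightarrow> real" where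
  "gain A B Q R p K = sqrt (stage_cost Q R K (snd p) / (norm (closed_loop A B (fst p) K (snd p)))\<^sup>2)"

lemma lambda_max_closed_loop:
  fixes w :: real
  assumes K: "K \<in> stab_set A B" and Q: "sym_pos_def Q" and R: "sym_pos_def R"
  defines "H \<equiv> transpose (matrix_inv (mat (exp (- \<i> * complex_of_real w)) - cmat A + cmat B ** cmat K))
           ** cmat (Q + transpose K ** R ** K)
           ** matrix_inv (mat (exp (\<i> * complex_of_real w)) - cmat A + cmat B ** cmat K)"
  shows "\<exists>x\<in>sphere 0 1. sqrt (lambda_max H) = gain A B Q R (w, x) K"
    and "x \<noteq> 0 \<Longrightarrow> gain A B Q R (w, x) K \<le> sqrt (lambda_max H)"
proof -
  let ?M = "mat (exp (\<i> * complex_of_real w)) - cmat A + cmat B ** cmat K"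
  let ?M' = "mat (exp (- \<i> * complex_of_real w)) - cmat A + cmat B ** cmat K"
  let ?S = "cmat (Q + transpose K ** R ** K)"
  have M: "?M *v x \<noteq> 0" if "x \<noteq> 0" for x
    using closed_loop_nonzero[OF K that] by (simp add: closed_loop_eq)
  have M': "?M' *v x \<noteq> 0" if "x \<noteq> 0" for x
    using closed_loop_nonzero[OF K that, of "- w"] closed_loop_eq[of "- w" A B K x] by simp
  have cnj: "cnj (exp (\<i> * complex_of_real w)) = exp (- (\<i> * complex_of_real w))"
    by (simp add: exp_cnj)
  \<comment> \<open>Since \<open>A\<close>, \<open>B\<close> and \<open>K\<close> are real, changing
    the sign of \<open>w\<close> conjugates the matrix. The plain transpose at \<open>- w\<close> is
    therefore the adjoint at \<open>w\<close>.\<close>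
  have "(\<chi> i j. cnj (?M $ j $ i)) = transpose ?M'"
    unfolding cmat_mult[symmetric]
    by (simp add: vec_eq_iff transpose_def mat_def cmat_def cnj)
  then have adj: "(?M *v x) \<bullet> y = x \<bullet> (transpose ?M' *v y)" for x y
    using inner_adjoint_complex[of ?M x y] by simp
  have "transpose (Q + transpose K ** R ** K) = Q + transpose K ** R ** K"
    using Q R by (simp add: sym_pos_def_def transpose_add matrix_transpose_mul matrix_mul_assoc)
  then have S: "(?S *v x) \<bullet> y = x \<bullet> (?S *v y)" for x y
    by (simp add: inner_adjoint_cmat)
  note * = lambda_max_congruence[OF M M' adj S, folded H_def, unfolded stage_cost_eq closed_loop_eq]
  show "\<exists>x\<in>sphere 0 1. sqrt (lambda_max H) = gain A B Q R (w, x) K"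
    using *(1) by (auto simp: gain_def)
  show "x \<noteq> 0 \<Longrightarrow> gain A B Q R (w, x) K \<le> sqrt (lambda_max H)"
    using *(2)[of x] by (simp add: gain_def)
qed

lemma closed_loop_continuous_on [continuous_intros]:
  assumes "continuous_on X f" "continuous_on X g" "continuous_on X k"
  shows "continuous_on X (\<lambda>z. closed_loop A B (f z) (g z) (k z))"
  unfolding closed_loop_def vector_scalar_mult_def
  by (intro continuous_intros assms bounded_bilinear.continuous_on[OF bounded_bilinear_cmat_mult_vec])

lemma stage_cost_continuous_on [continuous_intros]:
  assumes "continuous_on X f" "continuous_on X g"
  shows "continuous_on X (\<lambda>z. stage_cost Q R (f z) (g z))"
  unfolding stage_cost_def
  by (intro continuous_intros assms bounded_bilinear.continuous_on[OF bounded_bilinear_cmat_mult_vec])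

text \<open>The gain is continuous on a compact set and attains its maximum at some
  \<open>p0\<close>. For each frequency the maximum over unit vectors is the square root of
  \<open>lambda_max\<close>, so the supremum over frequencies is attained at
  \<open>fst p0\<close>.\<close>

lemma Hinf_cost_max:
  assumes K: "K \<in> stab_set A B" and Q: "sym_pos_def Q" and R: "sym_pos_def R"
  shows "\<exists>p \<in> {0..2*pi} \<times> sphere 0 1. Hinf_cost A B Q R K = gain A B Q R p K"
    and "p \<in> {0..2*pi} \<times> sphere 0 1 \<Longrightarrow> gain A B Q R p K \<le> Hinf_cost A B Q R K"
proof -
  let ?P = "{0..2*pi} \<times> sphere (0 :: complex ^ 'a) 1"
  have "continuous_on ?P (\<lambda>p. gain A B Q R p K)"
    unfolding gain_def
  proof (intro continuous_intros ballI)
    fix p assume "p \<in> ?P"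
    then have "snd p \<noteq> 0" by auto
    then show "(norm (closed_loop A B (fst p) K (snd p)))\<^sup>2 \<noteq> 0"
      using closed_loop_nonzero[OF K] by simp
  qed
  moreover have "compact ?P" "?P \<noteq> {}" by (auto simp: compact_Times)
  ultimately obtain p0 where p0: "p0 \<in> ?P" "\<And>p. p \<in> ?P \<Longrightarrow> gain A B Q R p K \<le> gain A B Q R p0 K"
    using continuous_attains_sup by metis
  define s where "s = (\<lambda>w. sqrt (lambda_max
          (transpose (matrix_inv (mat (exp (- \<i> * complex_of_real w)) - cmat A + cmat B ** cmat K))
           ** cmat (Q + transpose K ** R ** K)
           ** matrix_inv (mat (exp (\<i> * complex_of_real w)) - cmat A + cmat B ** cmat K))))"
  have s_le: "s w \<le> gain A B Q R p0 K" if "w \<in> {0..2*pi}" for w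
    using lambda_max_closed_loop(1)[OF K Q R, of w] p0(2) that unfolding s_def by force
  have "gain A B Q R p0 K \<le> s (fst p0)"
    using lambda_max_closed_loop(2)[OF K Q R, of "snd p0" "fst p0"] p0(1) unfolding s_def by force
  then have "s (fst p0) = gain A B Q R p0 K" using s_le[of "fst p0"] p0(1) by (auto intro: antisym)
  then have "(SUP w\<in>{0..2*pi}. s w) = gain A B Q R p0 K"
    by (intro cSup_eq_maximum) (use p0(1) s_le in force)+
  then have "Hinf_cost A B Q R K = gain A B Q R p0 K" unfolding Hinf_cost_def s_def .
  then show "\<exists>p \<in> ?P. Hinf_cost A B Q R K = gain A B Q R p K"
    and "p \<in> ?P \<Longrightarrow> gain A B Q R p K \<le> Hinf_cost A B Q R K"
    using p0 by auto
qed

section \<open>Differentiability of the gain and Lipschitz continuity of the cost\<close>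

text \<open>The quotient rule followed by the chain rule for the square root, written out so that
  joint continuity in all arguments can be read off.\<close>

definition gain_deriv :: "real ^ 'n ^ 'n \<Rightarrow> real ^ 'm ^ 'n \<Rightarrow> real ^ 'n ^ 'n \<Rightarrow> real ^ 'm ^ 'm
    \<Rightarrow> real \<times> (complex ^ 'n) \<Rightarrow> real ^ 'n ^ 'm \<Rightarrow> real ^ 'n ^ 'm \<Rightarrow> real" where
  "gain_deriv A B Q R p K V = (let x = snd p; y = closed_loop A B (fst p) K x; c = stage_cost Q R K x in
     (((cmat K *v x) \<bullet> (cmat R *v (cmat V *v x)) + (cmat V *v x) \<bullet> (cmat R *v (cmat K *v x))) * (y \<bullet> y)
       - c * (2 * (y \<bullet> (cmat B *v (cmat V *v x))))) / ((y \<bullet> y) * (y \<bullet> y))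
     / (2 * sqrt (c / (y \<bullet> y))))"

text \<open>Stability keeps the denominator away from 0, and positive definiteness keeps the
  argument of the square root positive, where the root is differentiable.\<close>

lemma gain_has_derivative:
  assumes K: "K \<in> stab_set A B" and Q: "sym_pos_def Q" and R: "sym_pos_def R" and p: "snd p \<noteq> 0"
  shows "(gain A B Q R p has_derivative gain_deriv A B Q R p K) (at K)"
proof -
  define x where "x = snd p"
  have x: "x \<noteq> 0" using p by (simp add: x_def)
  note [derivative_intros] =
    bounded_linear.has_derivative[OF bounded_bilinear.bounded_linear_left[OF bounded_bilinear_cmat_mult_vec]]
    bounded_linear.has_derivative[OF matrix_vector_mul_bounded_linear]
  have num: "((\<lambda>K. stage_cost Q R K x) has_derivative (\<lambda>V. (cmat K *v x) \<bullet> (cmat R *v (cmat V *v x))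
      + (cmat V *v x) \<bullet> (cmat R *v (cmat K *v x)))) (at K)"
    unfolding stage_cost_def by (auto intro!: derivative_eq_intros)
  have den: "((\<lambda>K. closed_loop A B (fst p) K x) has_derivative (\<lambda>V. cmat B *v (cmat V *v x))) (at K)"
    unfolding closed_loop_def by (auto intro!: derivative_eq_intros)
  have yy: "closed_loop A B (fst p) K x \<bullet> closed_loop A B (fst p) K x > 0"
    using closed_loop_nonzero[OF K x] by simp
  have "gain A B Q R p = (\<lambda>K. sqrt (stage_cost Q R K x
      / (closed_loop A B (fst p) K x \<bullet> closed_loop A B (fst p) K x)))"
    by (simp add: gain_def x_def power2_norm_eq_inner fun_eq_iff)
  moreover have "((\<lambda>K. sqrt (stage_cost Q R K x
      / (closed_loop A B (fst p) K x \<bullet> closed_loop A B (fst p) K x))) has_derivative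
      gain_deriv A B Q R p K) (at K)"
    using yy stage_cost_pos[OF Q R x, of K]
    by (auto intro!: derivative_eq_intros num den
        simp: gain_deriv_def Let_def x_def[symmetric] inner_commute fun_eq_iff field_simps)
  ultimately show ?thesis by simp
qed

lemma Hinf_cost_lipschitz:
  fixes C :: "(real ^ 'n ^ 'm) set"
  assumes C: "compact C" "convex C" "C \<subseteq> stab_set A B" and Q: "sym_pos_def Q" and R: "sym_pos_def R"
  shows "\<exists>L. L-lipschitz_on C (Hinf_cost A B Q R)"
proof (rule max_of_smooth_family_lipschitz[where h = "gain A B Q R" and h' = "gain_deriv A B Q R"
      and P = "{0..2*pi} \<times> sphere 0 1"])
  show "continuous_on (({0..2*pi} \<times> sphere 0 1) \<times> C \<times> sphere 0 1) (\<lambda>(p, K, V). gain_deriv A B Q R p K V)"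
    unfolding gain_deriv_def Let_def case_prod_beta
  proof (intro continuous_intros bounded_bilinear.continuous_on[OF bounded_bilinear_cmat_mult_vec]
      ballI)
    fix z assume z: "z \<in> ({0..2*pi} \<times> sphere (0 :: complex ^ 'n) 1) \<times> C \<times> sphere (0 :: real ^ 'n ^ 'm) 1"
    let ?x = "snd (fst z)" and ?K = "fst (snd z)"
    let ?y = "closed_loop A B (fst (fst z)) ?K ?x"
    have x: "?x \<noteq> 0" and K: "?K \<in> stab_set A B" using z C(3) by auto
    have y: "?y \<noteq> 0" by (rule closed_loop_nonzero[OF K x])
    then show "?y \<bullet> ?y \<noteq> 0" "?y \<bullet> ?y * (?y \<bullet> ?y) \<noteq> 0" by simp_all
    show "2 * sqrt (stage_cost Q R ?K ?x / (?y \<bullet> ?y)) \<noteq> 0"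
      using y stage_cost_pos[OF Q R x, of ?K] by simp
  qed
  show "(gain A B Q R p has_derivative gain_deriv A B Q R p K) (at K)"
    if "p \<in> {0..2*pi} \<times> sphere 0 1" "K \<in> C" for p K
  proof (rule gain_has_derivative[OF _ Q R])
    show "snd p \<noteq> 0" using that by auto
  qed (use that C in auto)
qed (use C Hinf_cost_max[OF _ Q R] in \<open>auto simp: compact_Times subset_iff\<close>)

section \<open>Convergence rate of the method\<close>

theorem theorem3:
  fixes A :: "real ^ 'nx ^ 'nx" and B :: "real ^ 'nu ^ 'nx"
    and Q :: "real ^ 'nx ^ 'nx" and R :: "real ^ 'nu ^ 'nu"
    and K :: "nat \<Rightarrow> real ^ 'nx ^ 'nu" and F :: "nat \<Rightarrow> real ^ 'nx ^ 'nu"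
    and \<delta> :: real
  defines "\<K> \<equiv> stab_set A B"
    and "J \<equiv> Hinf_cost A B Q R"
  defines "Jstar \<equiv> Inf (J ` \<K>)"
    and "\<Delta>\<^sub>0 \<equiv> setdist {K' \<in> \<K>. J K' \<le> J (K 0)} (- \<K>)"
  assumes "sym_pos_def Q" and "sym_pos_def R" and "stabilizable A B"
    and "K 0 \<in> \<K>" and "\<Delta>\<^sub>0 > 0"
    and "0 < \<delta>" and "\<delta> < \<Delta>\<^sub>0"
    and "\<And>n. min_norm_elem (F n) (goldstein_subdiff J \<K> \<delta> (K n))"
    and "\<And>n. K (Suc n) = K n - (\<delta> / norm (F n)) *\<^sub>R F n"
  shows "(\<forall>n. K n \<in> \<K>)
    \<and> (\<forall>N. (MIN n \<in> {..N}. norm (F n)) \<le> (J (K 0) - Jstar) / (real (N + 1) * \<delta>))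
    \<and> (\<forall>\<epsilon>>0. \<forall>N. real (N + 1) \<ge> (J (K 0) - Jstar) / (\<delta> * \<epsilon>) \<longrightarrow>
          (MIN n \<in> {..N}. norm (F n)) \<le> \<epsilon> \<and> (\<exists>n\<le>N. stationary_pt J \<K> \<delta> \<epsilon> (K n)))"
proof -
  note Q = \<open>sym_pos_def Q\<close> and R = \<open>sym_pos_def R\<close> and \<delta> = \<open>0 < \<delta>\<close>
    and F = \<open>\<And>n. min_norm_elem (F n) (goldstein_subdiff J \<K> \<delta> (K n))\<close>
  have sub: "\<exists>f f'. (f has_derivative f') (at y) \<and> f y = J y \<and> (\<forall>z\<in>\<K>. f z \<le> J z)" if y: "y \<in> \<K>" for y
  proof -
    obtain p where p: "p \<in> {0..2*pi} \<times> sphere 0 1" "J y = gain A B Q R p y"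
      using Hinf_cost_max(1)[OF _ Q R] y unfolding \<K>_def J_def by blast
    have "snd p \<noteq> 0" using p(1) by auto
    with y have "(gain A B Q R p has_derivative gain_deriv A B Q R p y) (at y)"
      unfolding \<K>_def by (intro gain_has_derivative Q R)
    with p show ?thesis
      using Hinf_cost_max(2)[OF _ Q R p(1)] unfolding \<K>_def J_def by metis
  qed
  have decrease: "K n \<in> \<K> \<and> J (K n) + \<delta> * (\<Sum>i<n. norm (F i)) \<le> J (K 0)" for n
  proof (rule goldstein_method_bound[OF _ sub])
    show "\<exists>L. L-lipschitz_on C J" if "compact C" "convex C" "C \<subseteq> \<K>" for C
      using Hinf_cost_lipschitz[OF _ _ _ Q R] that unfolding \<K>_def J_def by blast
  qed (use assms in auto)
  \<comment> \<open>The lower bound 0 on the costs makes the real \<open>Inf\<close> a genuine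
    infimum, so that \<open>Jstar\<close> lies below every cost.\<close>
  have J_nonneg: "0 \<le> J y" if y: "y \<in> \<K>" for y
  proof -
    obtain p where p: "p \<in> {0..2*pi} \<times> sphere 0 1" "J y = gain A B Q R p y"
      using Hinf_cost_max(1)[OF _ Q R] y unfolding \<K>_def J_def by blast
    have "snd p \<noteq> 0" using p(1) by auto
    then show ?thesis
      using stage_cost_pos[OF Q R, of "snd p" y] unfolding p(2) gain_def by simp
  qed
  have Jstar_le: "Jstar \<le> J (K n)" for n
    unfolding Jstar_def using decrease J_nonneg
    by (intro cInf_lower bdd_belowI[of _ 0]) auto
  have bound: "(MIN n \<in> {..N}. norm (F n)) \<le> (J (K 0) - Jstar) / (real (N + 1) * \<delta>)" for N
  proof -
    let ?m = "MIN n \<in> {..N}. norm (F n)"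
    \<comment> \<open>The indices 0 to \<open>N\<close> give \<open>N + 1\<close> terms, hence the
      summed descent is used at iterate \<open>Suc N\<close>.\<close>
    have "real (N + 1) * ?m = (\<Sum>i<Suc N. ?m)" by simp
    also have "\<dots> \<le> (\<Sum>i<Suc N. norm (F i))"
      by (intro sum_mono Min_le) auto
    finally have "\<delta> * (real (N + 1) * ?m) \<le> \<delta> * (\<Sum>i<Suc N. norm (F i))"
      using \<delta> by (intro mult_left_mono) auto
    also have "\<dots> \<le> J (K 0) - Jstar"
      using decrease[of "Suc N"] Jstar_le[of "Suc N"] by linarith
    finally have "?m * (real (N + 1) * \<delta>) \<le> J (K 0) - Jstar" by (simp only: mult_ac)
    then show ?thesis using \<delta> by (subst pos_le_divide_eq) auto
  qed
  have "(MIN n \<in> {..N}. norm (F n)) \<le> \<epsilon> \<and> (\<exists>n\<le>N. stationary_pt J \<K> \<delta> \<epsilon> (K n))"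
    if \<epsilon>: "\<epsilon> > 0" and N: "real (N + 1) \<ge> (J (K 0) - Jstar) / (\<delta> * \<epsilon>)" for \<epsilon> N
  proof -
    have "J (K 0) - Jstar \<le> real (N + 1) * (\<delta> * \<epsilon>)"
      using N \<epsilon> \<delta> by (subst (asm) pos_divide_le_eq) auto
    then have "(J (K 0) - Jstar) / (real (N + 1) * \<delta>) \<le> \<epsilon>"
      using \<delta> by (subst pos_divide_le_eq) (auto simp: mult_ac)
    then have min_le: "(MIN n \<in> {..N}. norm (F n)) \<le> \<epsilon>" using bound[of N] by linarith
    have "(MIN n \<in> {..N}. norm (F n)) \<in> (\<lambda>n. norm (F n)) ` {..N}" by (intro Min_in) auto
    then obtain n where "n \<le> N" "(MIN n \<in> {..N}. norm (F n)) = norm (F n)" by (elim imageE) simp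
    then have n: "n \<le> N" "norm (F n) \<le> \<epsilon>" using min_le by auto
    \<comment> \<open>\<open>F n\<close> belongs to the Goldstein subdifferential, so its norm
      bounds the distance of that set from 0.\<close>
    have "infdist 0 (goldstein_subdiff J \<K> \<delta> (K n)) \<le> dist 0 (F n)"
      using F[of n] by (intro infdist_le) (simp add: min_norm_elem_def)
    with n have "stationary_pt J \<K> \<delta> \<epsilon> (K n)" by (simp add: stationary_pt_def)
    with n min_le show ?thesis by blast
  qed
  with decrease bound show ?thesis by blast
qed

end
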